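(* Let $M,J\ge1$, $L\in\mathbb{N}=\{0,1,2,\dots\}$, and let $x^{(l)}_k\in\mathbb{R}$ for $1\le l\le J$, $0\le k\le M-1$, with Fourier coefficient vectors $\mathbf{a}^{(l)}\in\mathbb{C}^M$. There exists a real matrix $\tilde{\mathbf{K}}\in\mathbb{R}^{J(L+1)\times J}$ with $$\tilde x_{(k+1)\bmod M}=\tilde{\mathbf{K}}^\top\tilde{\mathbf{Y}}_k\qquad\text{for all }k\in\{0,\dots,M-1\}$$ if and only if there exists a solution $\tilde{\mathbf{K}}\in\mathbb{C}^{J(L+1)\times J}$ of the linear system $$\begin{bmatrix}\operatorname{diag}(\mathbf{a}^{(1)})&\dots&\operatorname{diag}(\mathbf{a}^{(J)})\end{bmatrix}\left(\begin{bmatrix}\mathbf{b}&&\\&\ddots&\\&&\mathbf{b}\end{bmatrix}-\begin{bmatrix}\mathbf{A}_{L}&&\\&\ddots&\\&&\mathbf{A}_{L}\end{bmatrix}\tilde{\mathbf{K}}\right)=\mathbf{0}$$ (with $J$ diagonal blocks in each block-diagonal matrix). Moreover, the existence of a solution of this linear system is equivalent to $$\operatorname{rank}\begin{bmatrix}\operatorname{diag}(\mathbf{a}^{(1)})\mathbf{A}_L&\dots&\operatorname{diag}(\mathbf{a}^{(J)})\mathbf{A}_L\end{bmatrix}=\operatorname{rank}\begin{bmatrix}\operatorname{diag}(\mathbf{a}^{(1)})\mathbf{A}_L&\dots&\operatorname{diag}(\mathbf{a}^{(J)})\mathbf{A}_L&\operatorname{diag}(\mathbf{a}^{(1)})\m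athbf{b}&\dots&\operatorname{diag}(\mathbf{a}^{(J)})\mathbf{b}\end{bmatrix}.$$
   Context: $j=\sqrt{-1}$, $\omega=e^{-j2\pi/M}$. $x^{(l)}_k$ are $M$ uniform samples over one period of the $l$-th component of a real $J$-dimensional periodic signal; sample indices are taken modulo $M$. $\mathbf{a}^{(l)}=(a^{(l)}_0,\dots,a^{(l)}_{M-1})^\top$ with $a^{(l)}_i=\frac1M\sum_{k=0}^{M-1}x^{(l)}_k e^{j2\pi ki/M}$, so $x^{(l)}_k=\sum_i a^{(l)}_i\omega^{ki}$. $\tilde x_k=(x^{(1)}_k,\dots,x^{(J)}_k)^\top\in\mathbb{R}^J$; $\mathbf{Y}^{(l)}_k=(x^{(l)}_{k\bmod M},x^{(l)}_{(k-1)\bmod M},\dots,x^{(l)}_{(k-L)\bmod M})^\top\in\mathbb{R}^{L+1}$; $\tilde{\mathbf{Y}}_k\in\mathbb{R}^{J(L+1)}$ is the vertical stack of $\mathbf{Y}^{(1)}_k,\dots,\mathbf{Y}^{(J)}_k$. $\mathbf{b}=(\omega^{0},\omega^{1},\dots,\omega^{M-1})^\top\in\mathbb{C}^{M}$, and $\mathbf{A}_{L}\in\mathbb{C}^{M\times(L+1)}$ has entries $(\mathbf{A}_L)_{i,l}=\omega^{-il}$, $0\le i\le M-1$, $0\le l\le L$. *)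

theory Defs
  imports Complex_Main "Jordan_Normal_Form.Matrix" "Jordan_Normal_Form.DL_Rank"
begin

text \<open>
  All indices start at 0. In particular the signal components are numbered \<open>0, \<dots>, J - 1\<close>,
  and \<open>x l k\<close> is sample \<open>k\<close> of component \<open>l\<close>; only the values with \<open>l < J\<close> and \<open>k < M\<close> matter.
\<close>

definition omega :: "nat \<Rightarrow> complex" where
  "omega M = exp (- (\<i> * 2 * of_real pi / of_nat M))"

definition fourier_coeffs :: "nat \<Rightarrow> (nat \<Rightarrow> real) \<Rightarrow> complex vec" where
  "fourier_coeffs M s = vec M (\<lambda>i. 1 / of_nat M *
     (\<Sum>k<M. of_real (s k) * exp (\<i> * 2 * of_real pi * of_nat k * of_nat i / of_nat M)))"

definition vstack_vec :: "'a vec list \<Rightarrow> 'a vec" where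
  "vstack_vec vs = vec_of_list (concat (map list_of_vec vs))"

text \<open>Horizontal concatenation of matrices that all have \<open>n\<close> rows.\<close>

definition hstack_mat :: "nat \<Rightarrow> 'a mat list \<Rightarrow> 'a mat" where
  "hstack_mat n As = mat_of_cols n (concat (map cols As))"

definition diag_of_vec :: "'a :: zero vec \<Rightarrow> 'a mat" where
  "diag_of_vec v = mat_diag (dim_vec v) (\<lambda>i. v $ i)"

definition sample_vec :: "nat \<Rightarrow> (nat \<Rightarrow> nat \<Rightarrow> real) \<Rightarrow> nat \<Rightarrow> real vec" where
  "sample_vec J x k = vec J (\<lambda>l. x l k)"

text \<open>
  The lag \<open>m\<close> may exceed \<open>k\<close>, and even \<open>M\<close>, so the difference \<open>k - m\<close> is reduced modulo \<open>M\<close>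
  over the integers.
\<close>

definition delay_vec :: "nat \<Rightarrow> nat \<Rightarrow> (nat \<Rightarrow> real) \<Rightarrow> nat \<Rightarrow> real vec" where
  "delay_vec M L s k = vec (L + 1) (\<lambda>m. s (nat ((int k - int m) mod int M)))"

definition stacked_delay_vec ::
    "nat \<Rightarrow> nat \<Rightarrow> nat \<Rightarrow> (nat \<Rightarrow> nat \<Rightarrow> real) \<Rightarrow> nat \<Rightarrow> real vec" where
  "stacked_delay_vec M J L x k = vstack_vec (map (\<lambda>l. delay_vec M L (x l) k) [0..<J])"

text \<open>The vector \<open>b\<close>, as a matrix with one column.\<close>

definition b_mat :: "nat \<Rightarrow> complex mat" where
  "b_mat M = mat M 1 (\<lambda>(i, _). omega M ^ i)"

definition A_mat :: "nat \<Rightarrow> nat \<Rightarrow> complex mat" where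
  "A_mat M L = mat M (L + 1) (\<lambda>(i, l). omega M powi (- (int i * int l)))"

end

theory Submission
  imports Defs
begin

text \<open>
  Multiplying out the blocks turns the linear system into \<open>S = R K\<close>, where the columns of \<open>R\<close>
  and \<open>S\<close> are those of all \<open>diag(a\<^sup>l) A\<^sub>L\<close> and all \<open>diag(a\<^sup>l) b\<close>. The rank criterion is then
  Rouche--Capelli: both say that the columns of \<open>S\<close> lie in the span of those of \<open>R\<close>.
  For a fixed complex \<open>K\<close>, entry \<open>(i, c)\<close> of \<open>S - R K\<close> is the \<open>i\<close>-th Fourier coefficient of the
  residual of the recurrence for component \<open>c\<close>, because a cyclic shift by \<open>d\<close> multiplies the
  \<open>i\<close>-th coefficient by \<open>\<omega>\<close> to the power \<open>d i\<close>. By Fourier inversion the system therefore says that the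
  residual vanishes. Since the samples are real, the real part of a complex \<open>K\<close> solves the
  recurrence whenever \<open>K\<close> does.
\<close>

subsection \<open>Block matrices\<close>

text \<open>Entry \<open>m\<close> of block \<open>l\<close> sits at flat position
  \<open>l * q + m\<close>. This convention is used for all stacked vectors and block matrices
  below, and the bound keeps such positions in range.\<close>

lemma block_index_less:
  fixes l m n q :: nat
  assumes "l < n" "m < q"
  shows "l * q + m < n * q"
proof -
  have "Suc l * q \<le> n * q" using assms by (intro mult_le_mono1) simp
  then show ?thesis using assms by simp
qed

lemma length_concat_map_upt:
  assumes "\<And>l. l < n \<Longrightarrow> length (f l) = q"
  shows "length (concat (map f [0..<n])) = n * q"
  using assms by (induction n) auto

lemma nth_concat_map_upt:
  assumes "\<And>l. l < n \<Longrightarrow> length (f l) = q" and "l < n" and "m < q"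
  shows "concat (map f [0..<n]) ! (l * q + m) = f l ! m"
  using assms
proof (induction n)
  case (Suc n)
  have len: "length (concat (map f [0..<n])) = n * q"
    using Suc.prems(1) by (intro length_concat_map_upt) simp
  show ?case
  proof (cases "l = n")
    case True
    then show ?thesis using len by (simp add: nth_append)
  next
    case False
    then have "l < n" using Suc.prems by simp
    then have "l * q + m < n * q" using Suc.prems(3) by (rule block_index_less)
    then show ?thesis using Suc len \<open>l < n\<close> by (simp add: nth_append)
  qed
qed simp

lemma sum_lessThan_mult:
  "(\<Sum>j<n * q. g j) = (\<Sum>l<n. \<Sum>m<q. g (l * q + m))" for g :: "nat \<Rightarrow> 'a :: comm_monoid_add"
proof -
  have "sum g {l * q..<l * q + q} = (\<Sum>m<q. g (l * q + m))" for l
    using sum.shift_bounds_nat_ivl[of g 0 "l * q" q] by (simp add: add.commute atLeast0LessThan)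
  then show ?thesis by (simp flip: sum.nat_group)
qed

lemma hstack_mat_carrier:
  assumes "\<And>l. l < n \<Longrightarrow> F l \<in> carrier_mat r q"
  shows "hstack_mat r (map F [0..<n]) \<in> carrier_mat r (n * q)"
proof -
  have "length (concat (map (\<lambda>l. cols (F l)) [0..<n])) = n * q"
    using assms by (intro length_concat_map_upt) (metis carrier_matD(2) cols_length)
  then show ?thesis by (auto simp: hstack_mat_def comp_def)
qed

lemma index_hstack_mat:
  assumes F: "\<And>l. l < n \<Longrightarrow> F l \<in> carrier_mat r q" and "i < r" "l < n" "m < q"
  shows "hstack_mat r (map F [0..<n]) $$ (i, l * q + m) = F l $$ (i, m)"
proof -
  let ?cs = "concat (map (\<lambda>l. cols (F l)) [0..<n])"
  have len: "length (cols (F l)) = q" if "l < n" for l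
    using F[OF that] by simp
  have "l * q + m < n * q" using \<open>l < n\<close> \<open>m < q\<close> by (rule block_index_less)
  moreover have "length ?cs = n * q"
    using len by (rule length_concat_map_upt)
  ultimately have "l * q + m < length ?cs" using \<open>m < q\<close> by simp
  then have "hstack_mat r (map F [0..<n]) $$ (i, l * q + m) = ?cs ! (l * q + m) $ i"
    using \<open>i < r\<close> by (simp add: hstack_mat_def mat_of_cols_def comp_def)
  also have "?cs ! (l * q + m) = col (F l) m"
    using nth_concat_map_upt[of n "\<lambda>l. cols (F l)" q l m, OF len \<open>l < n\<close> \<open>m < q\<close>]
      F[OF \<open>l < n\<close>] \<open>m < q\<close> by simp
  finally show ?thesis using F[OF \<open>l < n\<close>] \<open>i < r\<close> \<open>m < q\<close> by simp
qed

text \<open>The two lower blocks have no rows. Adding them makes the concatenation a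
  \<open>four_block_mat\<close>, so it can be multiplied blockwise with the recursively built
  \<open>diag_block_mat\<close>.\<close>

lemma hstack_mat_Cons:
  assumes "A \<in> carrier_mat r q"
  shows "hstack_mat r (A # As) =
    four_block_mat A (hstack_mat r As) (0\<^sub>m 0 q) (0\<^sub>m 0 (dim_col (hstack_mat r As)))"
proof (rule eq_matI, goal_cases)
  case (1 i j)
  then show ?case using assms by (auto simp: hstack_mat_def mat_of_cols_def nth_append)
qed (use assms in \<open>auto simp: hstack_mat_def\<close>)

lemma dim_row_hstack_mat [simp]: "dim_row (hstack_mat r As) = r"
  by (simp add: hstack_mat_def)

lemma dim_col_hstack_mat: "dim_col (hstack_mat r As) = sum_list (map dim_col As)"
  by (induction As) (auto simp: hstack_mat_def)

text \<open>Induction on the blocks: splitting off the first one on both sides gives a 2 by 2 block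
  product in which the off-diagonal zero blocks kill the mixed terms.\<close>

lemma hstack_mat_mult_diag_block_mat:
  fixes As Bs :: "'a :: semiring_0 mat list"
  assumes "list_all2 (\<lambda>A B. dim_row A = r \<and> dim_col A = dim_row B) As Bs"
  shows "hstack_mat r As * diag_block_mat Bs = hstack_mat r (map2 (*) As Bs)"
  using assms
proof (induction rule: list_all2_induct)
  case Nil
  show ?case by (intro eq_matI) (auto simp: hstack_mat_def)
next
  case (Cons A As B Bs)
  define H D where "H = hstack_mat r As" and "D = diag_block_mat Bs"
  \<comment> \<open>The inner dimensions of the tails agree because they agree block by block;
    without this the block product is not well formed.\<close>
  have dims: "dim_col H = dim_row D"
  proof -
    have "map dim_col As = map dim_row Bs"
      using Cons(2) by (auto simp: list_eq_iff_nth_eq list_all2_conv_all_nth)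
    then show ?thesis by (simp add: H_def D_def dim_col_hstack_mat dim_diag_block_mat)
  qed
  have AB: "A \<in> carrier_mat r (dim_row B)" "A * B \<in> carrier_mat r (dim_col B)"
    using Cons(1) by auto
  have "hstack_mat r (A # As) * diag_block_mat (B # Bs) =
    four_block_mat A H (0\<^sub>m 0 (dim_row B)) (0\<^sub>m 0 (dim_row D)) *
    four_block_mat B (0\<^sub>m (dim_row B) (dim_col D)) (0\<^sub>m (dim_row D) (dim_col B)) D"
    unfolding hstack_mat_Cons[OF AB(1)] by (simp add: H_def[symmetric] D_def[symmetric] Let_def dims)
  also have "\<dots> = four_block_mat
      (A * B + H * 0\<^sub>m (dim_row D) (dim_col B)) (A * 0\<^sub>m (dim_row B) (dim_col D) + H * D)
      (0\<^sub>m 0 (dim_row B) * B + 0\<^sub>m 0 (dim_row D) * 0\<^sub>m (dim_row D) (dim_col B))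
      (0\<^sub>m 0 (dim_row B) * 0\<^sub>m (dim_row B) (dim_col D) + 0\<^sub>m 0 (dim_row D) * D)"
    by (rule mult_four_block_mat[of _ r "dim_row B" _ "dim_row D" _ 0 _ _ "dim_col B" _ "dim_col D"])
      (use AB dims in \<open>auto simp: H_def\<close>)
  also have "\<dots> = four_block_mat (A * B) (H * D) (0\<^sub>m 0 (dim_col B)) (0\<^sub>m 0 (dim_col (H * D)))"
  proof -
    have H: "H \<in> carrier_mat r (dim_row D)" using dims by (auto simp: H_def)
    then have HD: "H * D \<in> carrier_mat r (dim_col D)" by auto
    show ?thesis
      using right_mult_zero_mat[OF AB(1), of "dim_col D"] right_mult_zero_mat[OF H, of "dim_col B"]
        right_add_zero_mat[OF AB(2)] left_add_zero_mat[OF HD] by simp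
  qed
  also have "\<dots> = hstack_mat r (map2 (*) (A # As) (B # Bs))"
    using hstack_mat_Cons[OF AB(2), of "map2 (*) As Bs"] Cons.IH by (simp add: H_def D_def)
  finally show ?case .
qed

lemma hstack_mat_map_mult_diag_block_mat_replicate:
  fixes F :: "nat \<Rightarrow> 'a :: semiring_0 mat"
  assumes "\<And>l. l < n \<Longrightarrow> F l \<in> carrier_mat r (dim_row B)"
  shows "hstack_mat r (map F [0..<n]) * diag_block_mat (replicate n B) =
    hstack_mat r (map (\<lambda>l. F l * B) [0..<n])"
proof -
  have "map2 (*) (map F [0..<n]) (replicate n B) = map (\<lambda>l. F l * B) [0..<n]"
    by (intro nth_equalityI) auto
  moreover have "list_all2 (\<lambda>A B. dim_row A = r \<and> dim_col A = dim_row B) (map F [0..<n]) (replicate n B)"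
    using assms unfolding list_all2_conv_all_nth by fastforce
  ultimately show ?thesis by (simp add: hstack_mat_mult_diag_block_mat)
qed

lemma diag_block_mat_replicate_carrier:
  assumes "B \<in> carrier_mat r q"
  shows "diag_block_mat (replicate n B) \<in> carrier_mat (n * r) (n * q)"
  using assms by (intro carrier_matI) (simp_all add: dim_diag_block_mat sum_list_replicate)

lemma index_vstack_vec:
  assumes "\<And>l. l < n \<Longrightarrow> dim_vec (f l) = q" and "l < n" "m < q"
  shows "vstack_vec (map f [0..<n]) $ (l * q + m) = f l $ m"
  using assms nth_concat_map_upt[of n "\<lambda>l. list_of_vec (f l)" q l m]
  by (simp add: vstack_vec_def vec_of_list_index list_of_vec_index comp_def)

lemma dim_vstack_vec:
  assumes "\<And>l. l < n \<Longrightarrow> dim_vec (f l) = q"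
  shows "dim_vec (vstack_vec (map f [0..<n])) = n * q"
  using assms length_concat_map_upt[of n "\<lambda>l. list_of_vec (f l)" q]
  by (simp add: vstack_vec_def comp_def)

subsection \<open>Rank of an augmented matrix\<close>

context vec_space
begin

text \<open>If the ranks agree, a maximal independent set of columns of \<open>A\<close> is still
  maximal among all columns, so it spans the columns of \<open>B\<close>. Conversely, appending
  columns from the span leaves the column space unchanged.\<close>

lemma rank_append_cols_eq_iff_subset_span:
  assumes A: "A \<in> carrier_mat n p" and B: "B \<in> carrier_mat n q"
  shows "rank A = rank (mat_of_cols n (cols A @ cols B)) \<longleftrightarrow>
    set (cols B) \<subseteq> span (set (cols A))"
proof -
  let ?AB = "mat_of_cols n (cols A @ cols B)"
  let ?indpt = "\<lambda>S T. T \<subseteq> S \<and> lin_indpt T"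
  have cA: "set (cols A) \<subseteq> carrier_vec n" and cB: "set (cols B) \<subseteq> carrier_vec n"
    using A B cols_dim[of A] cols_dim[of B] by simp_all
  have cols_AB: "set (cols ?AB) = set (cols A) \<union> set (cols B)"
    using cA cB by (subst cols_mat_of_cols) auto
  have AB: "?AB \<in> carrier_mat n (p + q)" using A B by (intro carrier_matI) auto
  show ?thesis
  proof
    assume eq: "rank A = rank ?AB"
    have indpt0: "lin_indpt {}" by (simp add: lin_dep_def)
    obtain U where finU: "finite U" and maxU: "maximal U (?indpt (set (cols A)))"
      using maximal_exists_superset[of "set (cols A)" "?indpt (set (cols A))" "{}"] indpt0 by auto
    then have U: "U \<subseteq> set (cols A)" "lin_indpt U" by (auto simp: maximal_def)
    \<comment> \<open>Extend \<open>U\<close> to a maximal independent set among the columns of the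
      augmented matrix; equal ranks then leave no room for \<open>W\<close> to be larger than
      \<open>U\<close>.\<close>
    then obtain W where W: "finite W" "maximal W (?indpt (set (cols ?AB)))" "U \<subseteq> W"
      using maximal_exists_superset[of "set (cols ?AB)" "?indpt (set (cols ?AB))" U] cols_AB by auto
    have "card U = card W"
      using eq rank_card_indpt[OF A maxU] rank_card_indpt[OF AB W(2)] by simp
    then have "W = U" using W card_subset_eq by metis
    have "b \<in> span U" if "b \<in> set (cols B)" for b
    proof (cases "b \<in> U")
      case True
      then show ?thesis using U cA by (meson span_mem subset_trans)
    next
      case False
      \<comment> \<open>Otherwise \<open>b\<close> could be added to \<open>W = U\<close>, against
        maximality.\<close>
      have "lin_dep (U \<union> {b})"
      proof (rule ccontr)
        assume "\<not> lin_dep (U \<union> {b})"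
        then have "?indpt (set (cols ?AB)) (U \<union> {b})"
          using that U cols_AB by auto
        then have "U \<union> {b} = U"
          using W(2) unfolding maximal_def \<open>W = U\<close> by blast
        then show False using False by auto
      qed
      then show ?thesis
        using False lin_dep_iff_in_span[of U b] U cA cB that by auto
    qed
    then show "set (cols B) \<subseteq> span (set (cols A))"
      using span_is_monotone[OF U(1)] by auto
  next
    assume "set (cols B) \<subseteq> span (set (cols A))"
    then have "span (set (cols ?AB)) \<subseteq> span (set (cols A))"
      unfolding cols_AB using cA in_own_span by (intro span_subsetI) auto
    moreover have "span (set (cols A)) \<subseteq> span (set (cols ?AB))"
      unfolding cols_AB by (intro span_is_monotone) auto
    ultimately show "rank A = rank ?AB" unfolding rank_def by simp
  qed
qed

text \<open>The span of the columns of \<open>A\<close> is the set of all products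
  \<open>A *\<^sub>v v\<close>, so the span condition solves \<open>B = A * K\<close> one column at
  a time.\<close>

lemma rouche_capelli:
  assumes A: "A \<in> carrier_mat n p" and B: "B \<in> carrier_mat n q"
  shows "rank A = rank (mat_of_cols n (cols A @ cols B)) \<longleftrightarrow> (\<exists>K \<in> carrier_mat p q. B = A * K)"
  unfolding rank_append_cols_eq_iff_subset_span[OF assms]
proof -
  have span_eq: "span (set (cols A)) = {A *\<^sub>v v | v. v \<in> carrier_vec p}"
  proof -
    have "A *\<^sub>v v \<in> carrier_vec n" for v using A by (simp add: carrier_vecI)
    moreover have "dim_row A = n" "dim_col A = p" using A by auto
    ultimately show ?thesis
      using col_space_eq[OF A] unfolding col_space_def by auto
  qed
  show "set (cols B) \<subseteq> span (set (cols A)) \<longleftrightarrow> (\<exists>K \<in> carrier_mat p q. B = A * K)"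
  proof
    assume "set (cols B) \<subseteq> span (set (cols A))"
    moreover have "col B j \<in> set (cols B)" if "j < q" for j
      using that B by (auto simp: cols_def)
    ultimately have "\<exists>v. v \<in> carrier_vec p \<and> col B j = A *\<^sub>v v" if "j < q" for j
      using that unfolding span_eq by blast
    then obtain v where v: "\<And>j. j < q \<Longrightarrow> v j \<in> carrier_vec p \<and> col B j = A *\<^sub>v v j"
      by metis
    \<comment> \<open>The chosen coefficient vectors of the columns of \<open>B\<close> become the
      columns of \<open>K\<close>.\<close>
    define K where "K = mat_of_cols p (map v [0..<q])"
    have K: "K \<in> carrier_mat p q" unfolding K_def by (intro carrier_matI) auto
    have colK: "col K j = v j" if "j < q" for j
      using that v by (simp add: K_def)
    have "B = A * K"
    proof (rule mat_col_eqI)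
      fix j assume "j < dim_col (A * K)"
      then have "j < q" using K by simp
      then show "col B j = col (A * K) j" using col_mult2[OF A K] v colK by metis
    qed (use A B K in auto)
    then show "\<exists>K \<in> carrier_mat p q. B = A * K" using K by blast
  next
    assume "\<exists>K \<in> carrier_mat p q. B = A * K"
    then obtain K where K: "K \<in> carrier_mat p q" "B = A * K" by blast
    show "set (cols B) \<subseteq> span (set (cols A))"
    proof
      fix b assume "b \<in> set (cols B)"
      then obtain j where "j < q" "b = col B j" using B by (auto simp: cols_def)
      then have "b = A *\<^sub>v col K j" using col_mult2[OF A K(1)] K(2) by metis
      moreover have "col K j \<in> carrier_vec p" using K by (intro carrier_vecI) simp
      ultimately show "b \<in> span (set (cols A))" unfolding span_eq by blast
    qed
  qed
qed

end

subsection \<open>Discrete Fourier transform\<close>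

lemma omega_eq_cis: "omega M = cis (- (2 * pi / of_nat M))"
  by (simp add: omega_def cis_conv_exp mult_ac)

lemma omega_nonzero [simp]: "omega M \<noteq> 0"
  by (simp add: omega_def)

lemma omega_power_self: "M \<ge> 1 \<Longrightarrow> omega M ^ M = 1"
  by (simp add: omega_eq_cis power_inverse DeMoivre flip: cis_inverse)

text \<open>Since \<open>omega M ^ M = 1\<close>, only the residue of the exponent modulo
  \<open>M\<close> counts. Integer exponents are used because lags give negative ones.\<close>

lemma omega_powi_cong:
  assumes "M \<ge> 1" and "a mod int M = b mod int M"
  shows "omega M powi a = omega M powi b"
proof -
  have "omega M powi c = omega M powi (c mod int M)" for c
  proof -
    have "omega M powi c = omega M powi (int M * (c div int M) + c mod int M)" by simp
    also have "\<dots> = (omega M powi int M) powi (c div int M) * omega M powi (c mod int M)"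
      by (simp only: power_int_add power_int_mult omega_nonzero simp_thms)
    also have "omega M powi int M = 1" using omega_power_self[OF assms(1)] by simp
    finally show ?thesis by simp
  qed
  then show ?thesis using assms(2) by metis
qed

text \<open>This is primitivity of the root. It follows from the injectivity of the standard
  enumeration of the roots of unity, which runs through positive angles; hence the passage to the
  inverse.\<close>

lemma omega_power_neq_one:
  assumes "0 < d" "d < M"
  shows "omega M ^ d \<noteq> 1"
proof
  assume "omega M ^ d = 1"
  then have "inverse (omega M ^ d) = 1" by simp
  then have "cis (2 * pi * real d / real M) = cis (2 * pi * real 0 / real M)"
    by (simp add: omega_eq_cis DeMoivre mult_ac)
  moreover have "inj_on (\<lambda>k. cis (2 * pi * real k / real M)) {..<M}"
    using bij_betw_roots_unity[of M] assms by (auto simp: bij_betw_def)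
  ultimately have "d = 0" using assms by (force dest!: inj_onD[of _ _ d 0])
  then show False using assms by simp
qed

text \<open>Orthogonality of the characters: off the diagonal this is a geometric sum whose ratio
  \<open>z\<close> satisfies \<open>z ^ M = 1\<close> and \<open>z \<noteq> 1\<close>.\<close>

lemma sum_omega_powi:
  assumes "k < M" "j < M"
  shows "(\<Sum>i<M. omega M powi ((int k - int j) * int i)) = (if k = j then of_nat M else 0)"
proof (cases "k = j")
  case False
  define z where "z = omega M powi (int k - int j)"
  have "z \<noteq> 1"
  proof (cases "j < k")
    case True
    then have "int k - int j = int (k - j)" by simp
    then have "z = omega M ^ (k - j)" unfolding z_def by (simp only: power_int_of_nat)
    then show ?thesis using True assms omega_power_neq_one[of "k - j" M] by simp
  next
    case False
    then have "int k - int j = - int (j - k)" by simp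
    then have "z = inverse (omega M ^ (j - k))"
      unfolding z_def by (simp only: power_int_minus power_int_of_nat)
    then show ?thesis using False \<open>k \<noteq> j\<close> assms omega_power_neq_one[of "j - k" M] by simp
  qed
  have "z ^ M = omega M powi ((int k - int j) * int M)"
    by (simp add: z_def power_int_mult)
  also have "\<dots> = omega M powi 0" using assms by (intro omega_powi_cong) auto
  finally have "z ^ M = 1" by simp
  have "(\<Sum>i<M. omega M powi ((int k - int j) * int i)) = (\<Sum>i<M. z ^ i)"
    by (simp add: z_def power_int_mult)
  also have "\<dots> = 0" using \<open>z \<noteq> 1\<close> \<open>z ^ M = 1\<close> by (simp add: sum_gp_strict)
  finally show ?thesis using False by simp
qed simp

text \<open>The transform behind \<open>fourier_coeffs\<close>, for complex sequences so that it
  also applies to residuals with complex coefficients. The exponent is negative because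
  \<open>omega M\<close> itself has a negative angle.\<close>

definition dft :: "nat \<Rightarrow> (nat \<Rightarrow> complex) \<Rightarrow> nat \<Rightarrow> complex" where
  "dft M s i = 1 / of_nat M * (\<Sum>k<M. s k * omega M powi (- (int k * int i)))"

lemma fourier_coeffs_eq_dft:
  assumes "i < M"
  shows "fourier_coeffs M s $ i = dft M (\<lambda>k. of_real (s k)) i"
proof -
  have "exp (\<i> * 2 * of_real pi * of_nat k * of_nat i / of_nat M) = omega M powi (- (int k * int i))" for k
  proof -
    have "omega M powi (- (int k * int i)) = inverse (omega M ^ (k * i))"
      by (simp only: power_int_minus power_int_of_nat flip: of_nat_mult)
    also have "\<dots> = exp (\<i> * 2 * of_real pi * of_nat k * of_nat i / of_nat M)"
      by (simp add: omega_def mult_ac flip: exp_of_nat_mult exp_minus)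
    finally show ?thesis by simp
  qed
  then show ?thesis using assms by (simp add: fourier_coeffs_def dft_def)
qed

text \<open>A cyclic shift permutes the sample indices, and modulo \<open>M\<close> the exponent
  \<open>- k i\<close> equals \<open>d i - (k + d) i\<close>; the factor belonging to
  \<open>d i\<close> comes out of the sum.\<close>

lemma dft_shift:
  assumes "M \<ge> 1"
  shows "dft M (\<lambda>k. s (nat ((int k + d) mod int M))) i = omega M powi (d * int i) * dft M s i"
proof -
  define sh where "sh e k = nat ((int k + e) mod int M)" for e k
  have int_sh: "int (sh e k) = (int k + e) mod int M" for e k
    using assms by (simp add: sh_def)
  have sh_less: "sh e k < M" for e k
    using assms by (simp add: sh_def nat_less_iff)
  \<comment> \<open>Shifts by \<open>e\<close> and \<open>- e\<close> cancel only on reduced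
    indices, hence the bound on \<open>k\<close>.\<close>
  have sh_inv: "sh e (sh (- e) k) = k" if "k < M" for e k
  proof -
    have "int (sh e (sh (- e) k)) = int k"
      unfolding int_sh using that by (simp add: mod_simps)
    then show ?thesis by simp
  qed
  have "omega M powi (- (int k * int i)) = omega M powi (d * int i) * omega M powi (- (int (sh d k) * int i))" for k
  proof -
    have "(- (int k * int i)) mod int M = (d * int i + - (int (sh d k) * int i)) mod int M"
    proof -
      have "(d * int i + - (int (sh d k) * int i)) mod int M = (d * int i - (int k + d) * int i) mod int M"
        unfolding int_sh by (metis mod_diff_right_eq mod_mult_left_eq uminus_add_conv_diff add.commute)
      then show ?thesis by (simp add: algebra_simps)
    qed
    then have "omega M powi (- (int k * int i)) = omega M powi (d * int i + - (int (sh d k) * int i))"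
      using assms by (intro omega_powi_cong)
    then show ?thesis by (simp only: power_int_add omega_nonzero simp_thms)
  qed
  then have "(\<Sum>k<M. s (sh d k) * omega M powi (- (int k * int i))) =
      (\<Sum>k<M. omega M powi (d * int i) * (s (sh d k) * omega M powi (- (int (sh d k) * int i))))"
    by (simp add: mult_ac)
  \<comment> \<open>The summand depends on \<open>k\<close> only through \<open>sh d k\<close>, and
    \<open>sh d\<close> is a bijection of the indices below \<open>M\<close> with inverse
    \<open>sh (- d)\<close>.\<close>
  also have "\<dots> = (\<Sum>k<M. omega M powi (d * int i) * (s k * omega M powi (- (int k * int i))))"
    by (rule sum.reindex_bij_witness[of _ "sh (- d)" "sh d"])
      (use sh_less sh_inv[of _ d] sh_inv[of _ "- d"] in auto)
  finally show ?thesis by (simp add: dft_def sh_def flip: sum_distrib_left)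
qed

text \<open>After exchanging the two sums, orthogonality leaves only the term
  \<open>j = k\<close>.\<close>

lemma dft_inversion:
  assumes "k < M"
  shows "(\<Sum>i<M. dft M s i * omega M powi (int k * int i)) = s k"
proof -
  have "(\<Sum>i<M. dft M s i * omega M powi (int k * int i)) =
      (\<Sum>i<M. \<Sum>j<M. s j / of_nat M * (omega M powi ((int k - int j) * int i)))"
    by (simp add: dft_def sum_distrib_left sum_distrib_right left_diff_distrib
        power_int_diff power_int_minus field_simps)
  also have "\<dots> = (\<Sum>j<M. s j / of_nat M * (\<Sum>i<M. omega M powi ((int k - int j) * int i)))"
    by (subst sum.swap) (simp add: sum_distrib_left)
  also have "\<dots> = (\<Sum>j<M. if j = k then s j else 0)"
    using assms by (intro sum.cong) (auto simp: sum_omega_powi)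
  also have "\<dots> = s k" using assms by simp
  finally show ?thesis .
qed

text \<open>Inversion makes the transform injective; this is what turns an identity of Fourier
  coefficients back into an identity of samples.\<close>

lemma dft_eq_zero_iff: "(\<forall>i<M. dft M s i = 0) \<longleftrightarrow> (\<forall>k<M. s k = 0)"
proof
  assume "\<forall>i<M. dft M s i = 0"
  then show "\<forall>k<M. s k = 0" using dft_inversion[of _ M s] by fastforce
qed (simp add: dft_def)

lemma dft_diff: "dft M (\<lambda>k. s k - t k) i = dft M s i - dft M t i"
  by (simp add: dft_def algebra_simps sum_subtractf)

lemma dft_cmult: "dft M (\<lambda>k. c * s k) i = c * dft M s i"
  by (simp add: dft_def sum_distrib_left mult_ac)

lemma dft_sum: "dft M (\<lambda>k. \<Sum>j\<in>A. s j k) i = (\<Sum>j\<in>A. dft M (s j) i)"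
  unfolding dft_def sum_distrib_left sum_distrib_right by (rule sum.swap)

subsection \<open>The linear system and the recurrence\<close>

lemma minus_mat_eq_zero_iff:
  fixes A B :: "'a :: ab_group_add mat"
  assumes "A \<in> carrier_mat r q" "B \<in> carrier_mat r q"
  shows "A - B = 0\<^sub>m r q \<longleftrightarrow> A = B"
proof
  assume "A - B = 0\<^sub>m r q"
  then have "(A - B) $$ (i, j) = 0" if "i < r" "j < q" for i j
    using that by simp
  then show "A = B" using assms by (intro eq_matI) auto
qed (use assms in auto)

lemma diag_of_vec_carrier: "v \<in> carrier_vec n \<Longrightarrow> diag_of_vec v \<in> carrier_mat n n"
  by (simp add: diag_of_vec_def)

lemma index_diag_of_vec_mult:
  fixes v :: "'a :: semiring_0 vec"
  assumes "v \<in> carrier_vec n" "A \<in> carrier_mat n q" "i < n" "j < q"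
  shows "(diag_of_vec v * A) $$ (i, j) = v $ i * A $$ (i, j)"
  using assms mat_diag_mult_left[of A n q "\<lambda>i. v $ i"] by (simp add: diag_of_vec_def)

lemma fourier_coeffs_carrier: "fourier_coeffs M s \<in> carrier_vec M"
  by (simp add: fourier_coeffs_def)

lemma A_mat_carrier: "A_mat M L \<in> carrier_mat M (L + 1)"
  by (simp add: A_mat_def)

lemma b_mat_carrier: "b_mat M \<in> carrier_mat M 1"
  by (simp add: b_mat_def)

text \<open>The common shape of both sides of the system: \<open>B = A_mat M L\<close> gives the
  matrix \<open>R\<close> of the overview, and \<open>B = b_mat M\<close> gives
  \<open>S\<close>.\<close>

definition hstack_diag_mult :: "nat \<Rightarrow> nat \<Rightarrow> (nat \<Rightarrow> complex vec) \<Rightarrow> complex mat \<Rightarrow> complex mat" where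
  "hstack_diag_mult M J a B = hstack_mat M (map (\<lambda>l. diag_of_vec (a l) * B) [0..<J])"

lemma hstack_diag_mult_carrier:
  assumes "\<And>l. l < J \<Longrightarrow> a l \<in> carrier_vec M" "B \<in> carrier_mat M q"
  shows "hstack_diag_mult M J a B \<in> carrier_mat M (J * q)"
  unfolding hstack_diag_mult_def
  using assms diag_of_vec_carrier by (intro hstack_mat_carrier) (blast intro: mult_carrier_mat)

lemma index_hstack_diag_mult:
  assumes "\<And>l. l < J \<Longrightarrow> a l \<in> carrier_vec M" "B \<in> carrier_mat M q"
    and "i < M" "l < J" "m < q"
  shows "hstack_diag_mult M J a B $$ (i, l * q + m) = a l $ i * B $$ (i, m)"
proof -
  have "diag_of_vec (a l) * B \<in> carrier_mat M q" if "l < J" for l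
    using assms(1)[OF that] assms(2) diag_of_vec_carrier mult_carrier_mat by blast
  then show ?thesis
    unfolding hstack_diag_mult_def
    using index_hstack_mat[of J "\<lambda>l. diag_of_vec (a l) * B" M q i l m]
      index_diag_of_vec_mult[OF assms(1)[OF \<open>l < J\<close>] assms(2) \<open>i < M\<close> \<open>m < q\<close>] assms(3-5) by simp
qed

text \<open>Distributing the row of diagonal blocks over the difference multiplies each
  \<open>diag_of_vec (a l)\<close> into its own copy of \<open>B\<close> or
  \<open>A\<close>.\<close>

lemma block_system_iff:
  assumes a: "\<And>l. l < J \<Longrightarrow> a l \<in> carrier_vec M"
    and B: "B \<in> carrier_mat M 1" and A: "A \<in> carrier_mat M q" and K: "K \<in> carrier_mat (J * q) J"
  shows "hstack_mat M (map (\<lambda>l. diag_of_vec (a l)) [0..<J])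
      * (diag_block_mat (replicate J B) - diag_block_mat (replicate J A) * K) = 0\<^sub>m M J
    \<longleftrightarrow> hstack_diag_mult M J a B = hstack_diag_mult M J a A * K"
proof -
  let ?H = "hstack_mat M (map (\<lambda>l. diag_of_vec (a l)) [0..<J])"
  let ?B = "diag_block_mat (replicate J B)" and ?A = "diag_block_mat (replicate J A)"
  have H: "?H \<in> carrier_mat M (J * M)"
    using a by (intro hstack_mat_carrier diag_of_vec_carrier)
  have dB: "?B \<in> carrier_mat (J * M) J"
    using diag_block_mat_replicate_carrier[OF B, of J] by simp
  have dA: "?A \<in> carrier_mat (J * M) (J * q)"
    using A by (rule diag_block_mat_replicate_carrier)
  have HX: "?H * diag_block_mat (replicate J X) = hstack_diag_mult M J a X" if "dim_row X = M" for X
    unfolding hstack_diag_mult_def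
    using a that by (intro hstack_mat_map_mult_diag_block_mat_replicate) (simp add: diag_of_vec_carrier)
  have "?H * (?B - ?A * K) = ?H * ?B - ?H * (?A * K)"
    using H dB dA K by (intro mult_minus_distrib_mat) auto
  also have "\<dots> = hstack_diag_mult M J a B - hstack_diag_mult M J a A * K"
    using HX[of A] HX[of B] A B assoc_mult_mat[OF H dA K] by simp
  finally have "?H * (?B - ?A * K) = hstack_diag_mult M J a B - hstack_diag_mult M J a A * K" .
  moreover have "hstack_diag_mult M J a B \<in> carrier_mat M J"
    using hstack_diag_mult_carrier[OF a B] by simp
  moreover have "hstack_diag_mult M J a A * K \<in> carrier_mat M J"
    using hstack_diag_mult_carrier[OF a A] K by (intro mult_carrier_mat)
  ultimately show ?thesis by (simp add: minus_mat_eq_zero_iff)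
qed

text \<open>Row \<open>l (L + 1) + m\<close> of \<open>K\<close> belongs to component \<open>l\<close> and lag \<open>m\<close>. The coefficients
  are complex so that both kinds of \<open>K\<close> can be compared.\<close>

definition predict ::
    "nat \<Rightarrow> nat \<Rightarrow> nat \<Rightarrow> (nat \<Rightarrow> nat \<Rightarrow> real) \<Rightarrow> complex mat \<Rightarrow> nat \<Rightarrow> nat \<Rightarrow> complex" where
  "predict M J L x K k c = (\<Sum>l<J. \<Sum>m<L + 1.
     K $$ (l * (L + 1) + m, c) * of_real (x l (nat ((int k - int m) mod int M))))"

lemma index_transpose_mult_stacked_delay_vec:
  assumes K: "K \<in> carrier_mat (J * (L + 1)) J" and "c < J"
  shows "complex_of_real ((transpose_mat K *\<^sub>v stacked_delay_vec M J L x k) $ c) =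
    predict M J L x (map_mat of_real K) k c"
proof -
  let ?Y = "stacked_delay_vec M J L x k"
  have dimY: "dim_vec ?Y = J * (L + 1)"
    unfolding stacked_delay_vec_def by (rule dim_vstack_vec) (simp add: delay_vec_def)
  have Y: "?Y $ (l * (L + 1) + m) = x l (nat ((int k - int m) mod int M))"
    if "l < J" "m < L + 1" for l m
    unfolding stacked_delay_vec_def
    using that index_vstack_vec[of J "\<lambda>l. delay_vec M L (x l) k" "L + 1" l m]
    by (simp add: delay_vec_def)
  have idx: "l * (L + 1) + m < J * (L + 1)" if "l < J" "m < L + 1" for l m
    using that by (rule block_index_less)
  have "(transpose_mat K *\<^sub>v ?Y) $ c = (\<Sum>j<J * (L + 1). K $$ (j, c) * ?Y $ j)"
    using K \<open>c < J\<close> dimY by (simp add: scalar_prod_def atLeast0LessThan)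
  also have "\<dots> = (\<Sum>l<J. \<Sum>m<L + 1. K $$ (l * (L + 1) + m, c) *
      x l (nat ((int k - int m) mod int M)))"
    unfolding sum_lessThan_mult by (intro sum.cong refl) (simp only: Y lessThan_iff)
  finally show ?thesis
    using K \<open>c < J\<close> idx by (simp add: predict_def)
qed

text \<open>Here \<open>K\<close> is fixed. The entries of \<open>b_mat\<close> and
  \<open>A_mat\<close> are exactly the factors produced by shifting one sample ahead and
  \<open>m\<close> samples back, so \<open>S - R K\<close> collects the Fourier coefficients of the
  residuals.\<close>

lemma dft_recurrence_iff:
  assumes "M \<ge> 1" and a: "\<And>l. l < J \<Longrightarrow> a l = fourier_coeffs M (x l)"
    and K: "K \<in> carrier_mat (J * (L + 1)) J"
  shows "hstack_diag_mult M J a (b_mat M) = hstack_diag_mult M J a (A_mat M L) * K \<longleftrightarrow>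
    (\<forall>k<M. \<forall>c<J. of_real (x c ((k + 1) mod M)) = predict M J L x K k c)"
proof -
  let ?S = "hstack_diag_mult M J a (b_mat M)" and ?R = "hstack_diag_mult M J a (A_mat M L)"
  have av: "a l \<in> carrier_vec M" if "l < J" for l
    using a[OF that] fourier_coeffs_carrier by simp
  have R: "?R \<in> carrier_mat M (J * (L + 1))" and S: "?S \<in> carrier_mat M J"
    using hstack_diag_mult_carrier[OF av A_mat_carrier]
      hstack_diag_mult_carrier[OF av b_mat_carrier] by auto
  have RK: "?R * K \<in> carrier_mat M J" using R K by (rule mult_carrier_mat)
  define res where "res c k = of_real (x c ((k + 1) mod M)) - predict M J L x K k c" for c k
  \<comment> \<open>Used with \<open>d = 1\<close> for the sample to be predicted and with
    \<open>d = - int m\<close> for lag \<open>m\<close>.\<close>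
  have dft_x: "dft M (\<lambda>k. of_real (x l (nat ((int k + d) mod int M)))) i =
      omega M powi (d * int i) * a l $ i" if "l < J" "i < M" for l d i
    using dft_shift[OF \<open>M \<ge> 1\<close>, of "\<lambda>k. of_real (x l k)" d i] a[OF \<open>l < J\<close>]
      fourier_coeffs_eq_dft[OF \<open>i < M\<close>] by simp
  \<comment> \<open>The blocks of \<open>?S\<close> have width 1, so column \<open>c\<close> is
    entry \<open>m = 0\<close> of block \<open>c\<close>.\<close>
  have Sic: "?S $$ (i, c) = omega M powi int i * a c $ i" if "c < J" "i < M" for i c
    using that index_hstack_diag_mult[OF av b_mat_carrier, where i = i and l = c and m = 0] by (simp add: b_mat_def)
  have RKic: "(?R * K) $$ (i, c) = (\<Sum>l<J. \<Sum>m<L + 1.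
      K $$ (l * (L + 1) + m, c) * (omega M powi (- int m * int i) * a l $ i))"
    if "c < J" "i < M" for i c
  proof -
    have "(?R * K) $$ (i, c) = (\<Sum>j<J * (L + 1). ?R $$ (i, j) * K $$ (j, c))"
      using that R K by (simp add: scalar_prod_def atLeast0LessThan)
    also have "\<dots> = (\<Sum>l<J. \<Sum>m<L + 1. ?R $$ (i, l * (L + 1) + m) * K $$ (l * (L + 1) + m, c))"
      by (rule sum_lessThan_mult)
    also have "\<dots> = (\<Sum>l<J. \<Sum>m<L + 1.
        K $$ (l * (L + 1) + m, c) * (omega M powi (- int m * int i) * a l $ i))"
    proof (intro sum.cong refl)
      fix l m assume "l \<in> {..<J}" "m \<in> {..<L + 1}"
      then show "?R $$ (i, l * (L + 1) + m) * K $$ (l * (L + 1) + m, c) =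
          K $$ (l * (L + 1) + m, c) * (omega M powi (- int m * int i) * a l $ i)"
        using that index_hstack_diag_mult[OF av A_mat_carrier, where i = i and l = l and m = m and L1 = L]
        by (simp add: A_mat_def mult_ac)
    qed
    finally show ?thesis .
  qed
  have "dft M (res c) i = ?S $$ (i, c) - (?R * K) $$ (i, c)" if "c < J" "i < M" for i c
  proof -
    have "nat ((int k + 1) mod int M) = (k + 1) mod M" for k
      by (simp add: nat_mod_distrib nat_add_distrib)
    then have "dft M (\<lambda>k. of_real (x c ((k + 1) mod M))) i = ?S $$ (i, c)"
      using dft_x[OF that, of 1] that by (simp add: Sic)
    moreover have "dft M (\<lambda>k. predict M J L x K k c) i = (?R * K) $$ (i, c)"
    proof -
      have "dft M (\<lambda>k. of_real (x l (nat ((int k - int m) mod int M)))) i =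
          omega M powi (- int m * int i) * a l $ i" if "l < J" for l m
        using dft_x[OF that \<open>i < M\<close>, of "- int m"] by simp
      then show ?thesis
        unfolding predict_def dft_sum dft_cmult RKic[OF that] by (intro sum.cong refl) simp
    qed
    ultimately show ?thesis unfolding res_def dft_diff by simp
  qed
  note dft_res = this
  have "?S = ?R * K \<longleftrightarrow> (\<forall>c<J. \<forall>i<M. dft M (res c) i = 0)"
  proof
    assume "\<forall>c<J. \<forall>i<M. dft M (res c) i = 0"
    then show "?S = ?R * K"
      using carrier_matD[OF S] carrier_matD[OF RK] dft_res
      by (intro eq_matI) (simp_all del: index_mult_mat)
  qed (use dft_res in simp)
  then show ?thesis unfolding dft_eq_zero_iff by (auto simp: res_def)
qed

text \<open>A real solution embeds into the complex matrices. Conversely, the prediction is linear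
  in \<open>K\<close> with real samples as weights, so taking real parts of \<open>K\<close> takes
  real parts of the prediction.\<close>

lemma real_recurrence_iff:
  "(\<exists>K \<in> (carrier_mat (J * (L + 1)) J :: real mat set). \<forall>k < M.
      sample_vec J x ((k + 1) mod M) = transpose_mat K *\<^sub>v stacked_delay_vec M J L x k) \<longleftrightarrow>
   (\<exists>K \<in> carrier_mat (J * (L + 1)) J.
      \<forall>k<M. \<forall>c<J. of_real (x c ((k + 1) mod M)) = predict M J L x K k c)"
  (is "?real \<longleftrightarrow> ?complex")
proof -
  have real_iff: "(\<forall>k<M. sample_vec J x ((k + 1) mod M) = transpose_mat K *\<^sub>v stacked_delay_vec M J L x k)
      \<longleftrightarrow> (\<forall>k<M. \<forall>c<J. of_real (x c ((k + 1) mod M)) = predict M J L x (map_mat of_real K) k c)"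
    if "K \<in> carrier_mat (J * (L + 1)) J" for K
  proof -
    have "sample_vec J x ((k + 1) mod M) = transpose_mat K *\<^sub>v stacked_delay_vec M J L x k \<longleftrightarrow>
      (\<forall>c<J. x c ((k + 1) mod M) = (transpose_mat K *\<^sub>v stacked_delay_vec M J L x k) $ c)" for k
      using that by (auto simp: sample_vec_def vec_eq_iff)
    then show ?thesis
      by (simp add: of_real_eq_iff flip: index_transpose_mult_stacked_delay_vec[OF that] del: index_mult_mat_vec)
  qed
  show ?thesis
  proof
    assume ?real
    then obtain K where K: "K \<in> carrier_mat (J * (L + 1)) J" "\<forall>k < M.
      sample_vec J x ((k + 1) mod M) = transpose_mat K *\<^sub>v stacked_delay_vec M J L x k" by blast
    then show ?complex
      by (intro bexI[of _ "map_mat of_real K"]) (simp_all only: real_iff map_carrier_mat)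
  next
    assume ?complex
    then obtain K where K: "K \<in> carrier_mat (J * (L + 1)) J"
      and eq: "\<forall>k<M. \<forall>c<J. of_real (x c ((k + 1) mod M)) = predict M J L x K k c" by blast
    have ReK: "map_mat Re K \<in> carrier_mat (J * (L + 1)) J" using K by simp
    have "predict M J L x (map_mat of_real (map_mat Re K)) k c = of_real (Re (predict M J L x K k c))"
      if "c < J" for k c
    proof -
      have "l * (L + 1) + m < J * (L + 1)" if "l < J" "m < L + 1" for l m
        using that by (rule block_index_less)
      then show ?thesis using K that by (simp add: predict_def Re_sum)
    qed
    \<comment> \<open>The left-hand side of the recurrence is real, so it equals the real part of
      the right-hand side.\<close>
    moreover have "complex_of_real (x c ((k + 1) mod M)) =
        of_real (Re (predict M J L x K k c))" if "k < M" "c < J" for k c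
      using eq that by (metis Re_complex_of_real)
    ultimately show ?real using real_iff[OF ReK] ReK by (intro bexI[of _ "map_mat Re K"]) simp_all
  qed
qed

theorem lemma3:
  fixes M J L :: nat
    and x :: "nat \<Rightarrow> nat \<Rightarrow> real"
    and a :: "nat \<Rightarrow> complex vec"
  assumes "M \<ge> 1" and "J \<ge> 1"
    and "\<And>l. l < J \<Longrightarrow> a l = fourier_coeffs M (x l)"
  shows
    "((\<exists>K \<in> (carrier_mat (J * (L + 1)) J :: real mat set). \<forall>k < M.
         sample_vec J x ((k + 1) mod M) = transpose_mat K *\<^sub>v stacked_delay_vec M J L x k)
      \<longleftrightarrow>
      (\<exists>K \<in> (carrier_mat (J * (L + 1)) J :: complex mat set).
         hstack_mat M (map (\<lambda>l. diag_of_vec (a l)) [0..<J])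
           * (diag_block_mat (replicate J (b_mat M))
              - diag_block_mat (replicate J (A_mat M L)) * K)
         = 0\<^sub>m M J))
     \<and>
     ((\<exists>K \<in> (carrier_mat (J * (L + 1)) J :: complex mat set).
         hstack_mat M (map (\<lambda>l. diag_of_vec (a l)) [0..<J])
           * (diag_block_mat (replicate J (b_mat M))
              - diag_block_mat (replicate J (A_mat M L)) * K)
         = 0\<^sub>m M J)
      \<longleftrightarrow>
      vec_space.rank M (hstack_mat M (map (\<lambda>l. diag_of_vec (a l) * A_mat M L) [0..<J]))
      = vec_space.rank M (hstack_mat M
          (map (\<lambda>l. diag_of_vec (a l) * A_mat M L) [0..<J]
           @ map (\<lambda>l. diag_of_vec (a l) * b_mat M) [0..<J])))"
proof -
  let ?R = "hstack_diag_mult M J a (A_mat M L)" and ?S = "hstack_diag_mult M J a (b_mat M)"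
  have a: "a l \<in> carrier_vec M" if "l < J" for l
    using assms(3)[OF that] fourier_coeffs_carrier by simp
  have R: "?R \<in> carrier_mat M (J * (L + 1))" and S: "?S \<in> carrier_mat M J"
    using hstack_diag_mult_carrier[OF a A_mat_carrier]
      hstack_diag_mult_carrier[OF a b_mat_carrier] by auto
  \<comment> \<open>Recovering the columns from \<open>mat_of_cols\<close> requires each of them to
    have dimension \<open>M\<close>. With this, the augmented matrix is seen to be the columns of
    \<open>?R\<close> followed by those of \<open>?S\<close>.\<close>
  have cols_hstack: "cols (hstack_diag_mult M J a B) =
      concat (map cols (map (\<lambda>l. diag_of_vec (a l) * B) [0..<J]))" for B
  proof -
    have "v \<in> carrier_vec M" if "l < J" "v \<in> set (cols (diag_of_vec (a l) * B))" for l v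
      using cols_dim[of "diag_of_vec (a l) * B"] diag_of_vec_carrier[OF a[OF that(1)]] that(2) by auto
    then have "set (concat (map cols (map (\<lambda>l. diag_of_vec (a l) * B) [0..<J]))) \<subseteq> carrier_vec M"
      by auto
    then show ?thesis unfolding hstack_diag_mult_def hstack_mat_def by (rule cols_mat_of_cols)
  qed
  have "hstack_mat M (map (\<lambda>l. diag_of_vec (a l) * A_mat M L) [0..<J]
      @ map (\<lambda>l. diag_of_vec (a l) * b_mat M) [0..<J]) = mat_of_cols M (cols ?R @ cols ?S)"
    unfolding cols_hstack hstack_mat_def by simp
  then have rank_iff: "vec_space.rank M ?R = vec_space.rank M (hstack_mat M
      (map (\<lambda>l. diag_of_vec (a l) * A_mat M L) [0..<J]
        @ map (\<lambda>l. diag_of_vec (a l) * b_mat M) [0..<J])) \<longleftrightarrow>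
      (\<exists>K \<in> carrier_mat (J * (L + 1)) J. ?S = ?R * K)"
    using vec_space.rouche_capelli[OF R S] by simp
  have system_iff: "(\<exists>K \<in> (carrier_mat (J * (L + 1)) J :: complex mat set).
      hstack_mat M (map (\<lambda>l. diag_of_vec (a l)) [0..<J])
        * (diag_block_mat (replicate J (b_mat M)) - diag_block_mat (replicate J (A_mat M L)) * K)
      = 0\<^sub>m M J) \<longleftrightarrow> (\<exists>K \<in> carrier_mat (J * (L + 1)) J. ?S = ?R * K)"
    using block_system_iff[OF a b_mat_carrier A_mat_carrier] by (intro bex_cong refl) simp
  have recurrence_iff: "(\<exists>K \<in> carrier_mat (J * (L + 1)) J. ?S = ?R * K) \<longleftrightarrow>
      (\<exists>K \<in> carrier_mat (J * (L + 1)) J.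
        \<forall>k<M. \<forall>c<J. of_real (x c ((k + 1) mod M)) = predict M J L x K k c)"
    using dft_recurrence_iff[OF assms(1,3)] by (intro bex_cong refl) simp
  show ?thesis
    \<comment> \<open>Both equivalences meet in the solvability of \<open>?S = ?R * K\<close> over
      the complex numbers.\<close>
    unfolding real_recurrence_iff system_iff recurrence_iff[symmetric]
    using rank_iff unfolding hstack_diag_mult_def by blast
qed

end
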